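(* Let $x,y$ be real numbers in a neighborhood of $1$ (that is, the following holds for all $x,y$ in some neighborhood of $1$ in $\mathbb{R}$). Then $$\frac{\pi^2}{2}\sum_{n=0}^\infty\frac{\left(\frac12\right)_n^2}{(n!)^2}\,P_{2n}\!\left(\frac{(x+y)(1-xy)}{(x-y)(1+xy)}\right)\left(\frac{x-y}{1+xy}\right)^{2n}$$ is equal to $$\begin{cases} \dfrac{\pi^2}{2} & \text{if } x=y=1,\\[2mm] \dfrac{1+xy}{xy}\,K\!\left(\dfrac{\sqrt{x^2-1}}{x}\right)K\!\left(\dfrac{\sqrt{y^2-1}}{y}\right) & \text{if } x,y\ge1,\\[2mm] \dfrac{1+xy}{x}\,K\!\left(\dfrac{\sqrt{x^2-1}}{x}\right)K\!\left(\sqrt{1-y^2}\right) & \text{if } x\ge1\text{ and }y\le1,\\[2mm] \dfrac{1+xy}{y}\,K\!\left(\sqrt{1-x^2}\right)K\!\left(\dfrac{\sqrt{y^2-1}}{y}\right) & \text{if } x\le1\text{ and }y\ge1,\\[2mm] (1+xy)\,K\!\left(\sqrt{1-x^2}\right)K\!\left(\sqrt{1-y^2}\right) & \text{if } x,y\le1. \end{cases}$$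
   Context: $(z)_n=\prod_{i=1}^n(z+i-1)$ is the Pochhammer symbol. $P_n$ denotes the Legendre polynomial of degree $n$, $P_n(z)={}_2F_1(-n,n+1;1;\frac{1-z}{2})$. $K:[0,1)\to[\pi/2,\infty)$ is the complete elliptic integral of the first kind, $K(k)=\frac{\pi}{2}\,{}_2F_1(\frac12,\frac12;1;k^2)$ (argument is the modulus $k$), where ${}_2F_1$ is the Gauss hypergeometric function. When $x=y$, each summand is understood as its continuous extension: $P_{2n}(A/B)B^{2n}$ is a polynomial in $A,B$, evaluated at the limiting values, with $B=\frac{x-y}{1+xy}$ and $A=\frac{(x+y)(1-xy)}{(1+xy)^2}$. *)

theory Defs
  imports "HOL-Analysis.Analysis"
begin

definition hyp2f1 :: "real \<Rightarrow> real \<Rightarrow> real \<Rightarrow> real \<Rightarrow> real" where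
  "hyp2f1 a b c z = eval_fps (fps_hypergeo [a, b] [c] 1) z"

lemma hyp2f1_altdef:
  "hyp2f1 a b c z =
     (\<Sum>n. pochhammer a n * pochhammer b n / (pochhammer c n * fact n) * z ^ n)"
  by (simp add: hyp2f1_def eval_fps_def mult_ac)

definition legendre_P :: "nat \<Rightarrow> real \<Rightarrow> real" where
  "legendre_P n z = hyp2f1 (- real n) (real n + 1) 1 ((1 - z) / 2)"

text \<open>The argument is the modulus (not the parameter); only meaningful for \<open>0 \<le> k < 1\<close>.\<close>

definition ellK :: "real \<Rightarrow> real" where
  "ellK k = pi / 2 * hyp2f1 (1/2) (1/2) 1 (k\<^sup>2)"

definition legendre_term_off_diag :: "nat \<Rightarrow> real \<Rightarrow> real \<Rightarrow> real" where
  "legendre_term_off_diag n x y =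
     legendre_P (2*n) (((x + y) * (1 - x*y)) / ((x - y) * (1 + x*y)))
       * ((x - y) / (1 + x*y)) ^ (2*n)"

text \<open>On the diagonal, where the argument of the Legendre polynomial is undefined, the term
  denotes its continuous extension. That this limit exists, and that it is the value of the
  polynomial \<open>B\<^sup>2\<^sup>n P\<^sub>2\<^sub>n(A/B)\<close> in \<open>A\<close> and \<open>B\<close>, is \<open>legendre_term_eq_hom\<close> below.\<close>

definition legendre_term :: "nat \<Rightarrow> real \<Rightarrow> real \<Rightarrow> real" where
  "legendre_term n x y =
     (if x \<noteq> y then legendre_term_off_diag n x y
      else Lim (at (x, y) within {(u, v). u \<noteq> v}) (\<lambda>(u, v). legendre_term_off_diag n u v))"

text \<open>The homogenisation \<open>B\<^sup>n P\<^sub>n(A/B)\<close>.\<close>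

definition legendre_hom :: "nat \<Rightarrow> real \<Rightarrow> real \<Rightarrow> real" where
  "legendre_hom n A B =
     (\<Sum>k\<le>n. pochhammer (- real n) k * pochhammer (real n + 1) k / (fact k)\<^sup>2
        * ((B - A) / 2) ^ k * B ^ (n - k))"

lemma legendre_P_altdef:
  "legendre_P n z = (\<Sum>k\<le>n. pochhammer (- real n) k * pochhammer (real n + 1) k / (fact k)\<^sup>2
     * ((1 - z) / 2) ^ k)"
proof -
  have "legendre_P n z = (\<Sum>k. pochhammer (- real n) k * pochhammer (real n + 1) k / (fact k)\<^sup>2
     * ((1 - z) / 2) ^ k)"
    by (simp add: legendre_P_def hyp2f1_altdef power2_eq_square flip: pochhammer_fact)
  also have "\<dots> = (\<Sum>k\<le>n. pochhammer (- real n) k * pochhammer (real n + 1) k / (fact k)\<^sup>2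
     * ((1 - z) / 2) ^ k)"
    by (rule suminf_finite) (auto simp: pochhammer_of_nat_eq_0_iff)
  finally show ?thesis .
qed

lemma legendre_P_mult_power:
  assumes "B \<noteq> 0"
  shows "legendre_P n (A / B) * B ^ n = legendre_hom n A B"
proof -
  have "((1 - A / B) / 2) ^ k * B ^ n = ((B - A) / 2) ^ k * B ^ (n - k)" if "k \<le> n" for k
  proof -
    have "((1 - A / B) / 2) ^ k * B ^ n = ((1 - A / B) / 2) ^ k * B ^ k * B ^ (n - k)"
      using that by (simp flip: power_add)
    also have "((1 - A / B) / 2) ^ k * B ^ k = ((1 - A / B) / 2 * B) ^ k"
      by (simp only: power_mult_distrib)
    also have "(1 - A / B) / 2 * B = (B - A) / 2"
      using assms by (simp add: field_simps)
    finally show ?thesis .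
  qed
  then show ?thesis
    unfolding legendre_P_altdef legendre_hom_def sum_distrib_right
    by (intro sum.cong) (auto simp: mult.assoc)
qed

lemma legendre_term_off_diag_eq_hom:
  assumes "x \<noteq> y" "1 + x*y \<noteq> 0"
  shows "legendre_term_off_diag n x y =
     legendre_hom (2*n) ((x + y) * (1 - x*y) / (1 + x*y)\<^sup>2) ((x - y) / (1 + x*y))"
proof -
  have "((x + y) * (1 - x*y)) / ((x - y) * (1 + x*y)) =
      ((x + y) * (1 - x*y) / (1 + x*y)\<^sup>2) / ((x - y) / (1 + x*y))"
    using assms by (simp add: power2_eq_square)
  then show ?thesis
    unfolding legendre_term_off_diag_def using assms
    by (simp only:) (rule legendre_P_mult_power, simp)
qed

lemma tendsto_legendre_term_off_diag:
  fixes x :: real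
  shows "((\<lambda>(u, v). legendre_term_off_diag n u v) \<longlongrightarrow>
     legendre_hom (2*n) ((x + x) * (1 - x*x) / (1 + x*x)\<^sup>2) 0)
     (at (x, x) within {(u, v). u \<noteq> v})"
proof -
  let ?F = "at (x, x) within {(u, v). u \<noteq> v}"
  have nz: "1 + x * x \<noteq> 0"
    using zero_le_square[of x] by linarith
  let ?h = "\<lambda>p::real \<times> real. legendre_hom (2*n)
      ((fst p + snd p) * (1 - fst p * snd p) / (1 + fst p * snd p)\<^sup>2)
      ((fst p - snd p) / (1 + fst p * snd p))"
  have fs: "(fst \<longlongrightarrow> x) ?F" "(snd \<longlongrightarrow> x) ?F"
    using tendsto_fst[OF tendsto_ident_at, of "(x, x)"] tendsto_snd[OF tendsto_ident_at, of "(x, x)"]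
    by auto
  have "(?h \<longlongrightarrow> legendre_hom (2*n) ((x + x) * (1 - x*x) / (1 + x*x)\<^sup>2) ((x - x) / (1 + x*x))) ?F"
    unfolding legendre_hom_def using nz by (intro tendsto_intros fs) auto
  moreover have "((\<lambda>p. 1 + fst p * snd p) \<longlongrightarrow> 1 + x * x) ?F"
    by (intro tendsto_intros fs)
  then have "\<forall>\<^sub>F p in ?F. 1 + fst p * snd p \<noteq> 0"
    using nz tendsto_imp_eventually_ne by blast
  then have "\<forall>\<^sub>F p in ?F. ?h p = (case p of (u, v) \<Rightarrow> legendre_term_off_diag n u v)"
    unfolding eventually_at_filter
    by eventually_elim (auto simp: legendre_term_off_diag_eq_hom)
  ultimately show ?thesis
    using tendsto_cong by fastforce
qed

lemma legendre_term_eq_hom: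
  assumes "1 + x*y \<noteq> 0"
  shows "legendre_term n x y =
     legendre_hom (2*n) ((x + y) * (1 - x*y) / (1 + x*y)\<^sup>2) ((x - y) / (1 + x*y))"
proof (cases "x = y")
  case True
  have "(y, y) islimpt {(u, v). u \<noteq> (v::real)}"
    unfolding islimpt_approachable
  proof (intro allI impI)
    fix e :: real assume "e > 0"
    then show "\<exists>p\<in>{(u, v). u \<noteq> v}. p \<noteq> (y, y) \<and> dist p (y, y) < e"
      by (intro bexI[of _ "(y + e/2, y)"]) (auto simp: dist_Pair_Pair dist_real_def)
  qed
  then have "\<not> trivial_limit (at (y, y) within {(u, v). u \<noteq> (v::real)})"
    by (simp add: trivial_limit_within)
  from tendsto_Lim[OF this tendsto_legendre_term_off_diag] show ?thesis
    using True by (simp add: legendre_term_def)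
next
  case False
  with assms show ?thesis
    by (simp add: legendre_term_def legendre_term_off_diag_eq_hom)
qed

end

theory Submission
  imports Defs
begin

text \<open>
  Write \<open>p\<^sub>m = B\<^sup>m P\<^sub>m(A/B)\<close>, \<open>w\<^sub>n = (1/2)\<^sub>n\<^sup>2 / n!\<^sup>2\<close> and \<open>g x = \<^sub>2F\<^sub>1(1/2, 1/2; 1; 1 - x\<^sup>2)\<close>, so that
  \<open>K(\<surd>(1 - x\<^sup>2)) = \<pi>/2 g x\<close> for \<open>0 < x \<le> 1\<close>. Pfaff's transformation \<open>g (1/x) = x g x\<close> turns this into
  \<open>K(\<surd>(x\<^sup>2 - 1) / x) = \<pi>/2 x g x\<close> for \<open>x \<ge> 1\<close>, and then all the cases of the theorem say the
  same thing: \<open>2 (\<Sum>n. w\<^sub>n p\<^sub>2\<^sub>n) = (1 + x y) g x g y\<close>.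

  The function \<open>g\<close> is a solution of the complementary elliptic equation \<open>L g = 0\<close>, where
  \<open>L h = (x (1 - x\<^sup>2) h')' - x h\<close>. The series solves the same equation in \<open>x\<close> after division by
  \<open>1 + x y\<close>, because of the identity
  \<open>(1 + x y) L (p\<^sub>m / (1 + x y)) = m\<^sup>2 p\<^sub>m\<^sub>-\<^sub>1 - (m + 1)\<^sup>2 p\<^sub>m\<^sub>+\<^sub>1\<close> (lemma \<open>has_flux_legendre_term\<close>):
  weighted with \<open>w\<^sub>n\<close> and summed over \<open>m = 2 n\<close>, the right-hand side telescopes, since
  \<open>(2 n + 2)\<^sup>2 w\<^sub>n\<^sub>+\<^sub>1 = (2 n + 1)\<^sup>2 w\<^sub>n\<close>. The identity itself comes from the fact that the derivation
  \<open>x (1 - x\<^sup>2) d/dx\<close> moves the point \<open>(A, B)\<close> by an infinitesimal scaling and hyperbolic rotation,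
  under which the Legendre polynomials transform linearly (\<open>has_flux_legendre_hom\<close>).

  At \<open>x = 1\<close> the equation is singular and has, up to a factor, only one regular solution. A Wronskian
  argument (\<open>wronskian_estimate\<close>), robust enough to be applied to partial sums with their
  residuals, therefore shows that the series divided by \<open>1 + x y\<close> is its value at \<open>x = 1\<close> times
  \<open>g x\<close>. The series is symmetric in \<open>x\<close> and \<open>y\<close>, so the value at \<open>(1, y)\<close> is the one at
  \<open>(1, 1)\<close>, which is \<open>1/2\<close>, times \<open>g y\<close>. The same uniqueness gives Pfaff's transformation.
\<close>

section \<open>Homogenised Legendre polynomials\<close>

text \<open>The coefficient of \<open>((B - A) / 2)\<^sup>k B\<^sup>n\<^sup>-\<^sup>k\<close> in \<open>B\<^sup>n P\<^sub>n(A/B)\<close>; up to the sign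
  \<open>(-1)\<^sup>k\<close> it is \<open>(n + k)! / ((n - k)! k!\<^sup>2)\<close>.\<close>
definition legendre_coeff :: "nat \<Rightarrow> nat \<Rightarrow> real" where
  "legendre_coeff n k =
     pochhammer (- real n) k * pochhammer (real n + 1) k / (fact k)\<^sup>2"

lemma legendre_coeff_eq_0: "n < k \<Longrightarrow> legendre_coeff n k = 0"
  by (simp add: legendre_coeff_def pochhammer_of_nat_eq_0_iff)

lemma legendre_coeff_0 [simp]: "legendre_coeff n 0 = 1"
  by (simp add: legendre_coeff_def)

text \<open>Bonnet's three-term recurrence for the Legendre polynomials, read off coefficient by
  coefficient after writing their argument as \<open>1 - 2 t\<close>. The four Pochhammer quotients share the
  factor \<open>\<kappa>\<close> of the proof, and what is left is an identity between polynomials in \<open>n\<close> and \<open>k\<close>.\<close>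
lemma legendre_coeff_rec:
  assumes "n \<ge> 1"
  shows "(real n + 1) * legendre_coeff (Suc n) (Suc k) =
    (2 * real n + 1) * (legendre_coeff n (Suc k) - 2 * legendre_coeff n k)
      - real n * legendre_coeff (n - 1) (Suc k)"
proof (cases k)
  case 0
  then show ?thesis
    using assms by (simp add: legendre_coeff_def of_nat_diff field_simps)
next
  case (Suc i)
  define X where "X = pochhammer (1 - real n) i"
  define Y where "Y = pochhammer (real n + 2) i"
  define \<nu> where "\<nu> = real n"
  define j where "j = real k"
  have j: "real i = j - 1" using Suc by (simp add: j_def)
  have f: "(fact (Suc k))\<^sup>2 = (j + 1)\<^sup>2 * (fact k :: real)\<^sup>2"
    by (simp add: j_def power_mult_distrib add.commute)
  have x1: "pochhammer (- real n) k = - \<nu> * X"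
    unfolding Suc X_def \<nu>_def by (simp add: pochhammer_rec add.commute)
  have x2: "pochhammer (- real n) (Suc k) = - \<nu> * X * (j - \<nu>)"
    unfolding pochhammer_Suc[of _ k] x1 by (simp add: \<nu>_def j_def)
  have x3: "pochhammer (- real (Suc n)) (Suc k) = (\<nu> + 1) * \<nu> * X"
    unfolding pochhammer_rec[of _ k] using x1 by (simp add: \<nu>_def algebra_simps)
  have x4: "pochhammer (- real (n - 1)) (Suc k) = X * (j - \<nu>) * (j + 1 - \<nu>)"
    using assms unfolding X_def \<nu>_def Suc j_def
    by (simp add: pochhammer_Suc of_nat_diff algebra_simps)
  have y1: "pochhammer (real n + 1) k = (\<nu> + 1) * Y"
    unfolding Suc Y_def \<nu>_def by (simp add: pochhammer_rec add.commute)
  have y2: "pochhammer (real n + 1) (Suc k) = (\<nu> + 1) * Y * (\<nu> + 1 + j)"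
    unfolding pochhammer_Suc[of _ k] y1 by (simp add: \<nu>_def j_def)
  have y3: "pochhammer (real (Suc n) + 1) (Suc k) = Y * (\<nu> + 1 + j) * (\<nu> + 2 + j)"
    unfolding Suc Y_def \<nu>_def j_def by (simp add: pochhammer_Suc algebra_simps)
  have y4: "pochhammer (real (n - 1) + 1) (Suc k) = \<nu> * (\<nu> + 1) * Y"
    unfolding pochhammer_rec[of _ k] using y1 assms by (simp add: \<nu>_def of_nat_diff)
  define \<kappa> where "\<kappa> = \<nu> * (\<nu> + 1) * X * Y / ((j + 1)\<^sup>2 * (fact k)\<^sup>2)"
  have "(j + 1)\<^sup>2 \<noteq> 0" by (simp add: j_def add_nonneg_eq_0_iff)
  then have c1: "legendre_coeff (Suc n) (Suc k) = \<kappa> * ((\<nu> + 1 + j) * (\<nu> + 2 + j))"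
    and c2: "legendre_coeff n (Suc k) = \<kappa> * ((\<nu> - j) * (\<nu> + 1 + j))"
    and c3: "legendre_coeff n k = - \<kappa> * (j + 1)\<^sup>2"
    and c4: "legendre_coeff (n - 1) (Suc k) = \<kappa> * ((\<nu> - j) * (\<nu> - 1 - j))"
    unfolding legendre_coeff_def x1 x2 x3 x4 y1 y2 y3 y4 f \<kappa>_def
    by (simp_all add: field_simps)
  show ?thesis
    unfolding c1 c2 c3 c4 \<nu>_def[symmetric] by (simp add: algebra_simps power2_eq_square)
qed

lemma legendre_hom_0 [simp]: "legendre_hom 0 A B = 1"
  by (simp add: legendre_hom_def)

lemma legendre_hom_1 [simp]: "legendre_hom (Suc 0) A B = A"
  by (simp add: legendre_hom_def field_simps)

text \<open>Padding with powers of \<open>B\<close> brings polynomials of different degrees to the common degree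
  \<open>N\<close>, so that identities between them can be compared monomial by monomial.\<close>
lemma legendre_hom_upto:
  assumes "n \<le> N"
  shows "B ^ (N - n) * legendre_hom n A B =
    (\<Sum>k\<le>N. legendre_coeff n k * ((B - A) / 2) ^ k * B ^ (N - k))"
proof -
  have "B ^ (N - n) * legendre_hom n A B =
      (\<Sum>k\<le>n. legendre_coeff n k * ((B - A) / 2) ^ k * B ^ (N - k))"
    unfolding legendre_hom_def legendre_coeff_def sum_distrib_left
    using assms by (intro sum.cong refl) (simp flip: power_add)
  also have "\<dots> = (\<Sum>k\<le>N. legendre_coeff n k * ((B - A) / 2) ^ k * B ^ (N - k))"
    using assms by (intro sum.mono_neutral_left) (auto simp: legendre_coeff_eq_0)
  finally show ?thesis .
qed

text \<open>Bonnet's recurrence in homogeneous form. At \<open>n = 0\<close> the factor \<open>real n\<close> removes the last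
  term, so the truncated index \<open>n - 1\<close> is harmless.\<close>
lemma legendre_hom_rec:
  "(real n + 1) * legendre_hom (Suc n) A B =
     (2 * real n + 1) * A * legendre_hom n A B - real n * B\<^sup>2 * legendre_hom (n - 1) A B"
proof (cases "n = 0")
  case False
  then have n: "n \<ge> 1" by simp
  define D where "D = (B - A) / 2"
  define b where "b = legendre_coeff"
  define M where "M = (\<lambda>k. D ^ k * B ^ (Suc n - k))"
  have upper: "legendre_hom (Suc n) A B = (\<Sum>k\<le>Suc n. b (Suc n) k * M k)"
    using legendre_hom_upto[of "Suc n" "Suc n" B A] by (simp add: D_def b_def M_def mult.assoc)
  have mid: "B * legendre_hom n A B = (\<Sum>k\<le>Suc n. b n k * M k)"
    using legendre_hom_upto[of n "Suc n" B A] by (simp add: D_def b_def M_def mult.assoc)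
  have lower: "B\<^sup>2 * legendre_hom (n - 1) A B = (\<Sum>k\<le>Suc n. b (n - 1) k * M k)"
    using legendre_hom_upto[of "n - 1" "Suc n" B A] n
    by (simp add: D_def b_def M_def mult.assoc power2_eq_square)
  have shifted: "D * legendre_hom n A B = (\<Sum>k\<le>n. b n k * M (Suc k))"
    using legendre_hom_upto[of n n B A]
    by (simp add: D_def b_def M_def sum_distrib_left mult_ac)
  have "(real n + 1) * legendre_hom (Suc n) A B =
      (real n + 1) * M 0 + (\<Sum>k\<le>n. (real n + 1) * b (Suc n) (Suc k) * M (Suc k))"
    unfolding upper sum.atMost_Suc_shift
    by (simp add: b_def sum_distrib_left algebra_simps)
  also have "(\<Sum>k\<le>n. (real n + 1) * b (Suc n) (Suc k) * M (Suc k)) =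
      (\<Sum>k\<le>n. ((2 * real n + 1) * (b n (Suc k) - 2 * b n k) - real n * b (n - 1) (Suc k)) * M (Suc k))"
    using legendre_coeff_rec[OF n] by (intro sum.cong refl) (simp add: b_def)
  also have "\<dots> = (2 * real n + 1) * (\<Sum>k\<le>n. b n (Suc k) * M (Suc k))
      - 2 * (2 * real n + 1) * (\<Sum>k\<le>n. b n k * M (Suc k))
      - real n * (\<Sum>k\<le>n. b (n - 1) (Suc k) * M (Suc k))"
    unfolding sum_distrib_left sum_subtractf[symmetric]
    by (intro sum.cong refl) (simp add: algebra_simps)
  also have "(\<Sum>k\<le>n. b n (Suc k) * M (Suc k)) = B * legendre_hom n A B - M 0"
    unfolding mid sum.atMost_Suc_shift by (simp add: b_def)
  also have "(\<Sum>k\<le>n. b (n - 1) (Suc k) * M (Suc k)) = B\<^sup>2 * legendre_hom (n - 1) A B - M 0"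
    unfolding lower sum.atMost_Suc_shift by (simp add: b_def)
  also note shifted[symmetric]
  finally show ?thesis
    by (simp add: D_def field_simps)
qed simp

text \<open>Only \<open>B\<^sup>2\<close> occurs in the recurrence. This is what makes the series symmetric: exchanging
  \<open>x\<close> and \<open>y\<close> fixes \<open>A\<close> and changes the sign of \<open>B\<close>.\<close>
lemma legendre_hom_uminus [simp]: "legendre_hom n A (- B) = legendre_hom n A B"
proof (induction n rule: less_induct)
  case (less n)
  show ?case
  proof (cases n)
    case (Suc m)
    have "(real m + 1) * legendre_hom n A (- B) = (real m + 1) * legendre_hom n A B"
      unfolding Suc legendre_hom_rec using less[of m] less[of "m - 1"] Suc by simp
    then show ?thesis by simp
  qed simp
qed

text \<open>The recurrence gives a bound with ratio \<open>r\<close> as soon as \<open>2 \<rho> r + \<rho>\<^sup>2 \<le> r\<^sup>2\<close>; the choice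
  \<open>r = 3 \<rho>\<close> is a convenient one. It yields geometric convergence near \<open>A = B = 0\<close>, that is, near
  \<open>x = y = 1\<close>.\<close>
lemma abs_legendre_hom_le:
  assumes "\<bar>A\<bar> \<le> \<rho>" "\<bar>B\<bar> \<le> \<rho>"
  shows "\<bar>legendre_hom n A B\<bar> \<le> (3 * \<rho>) ^ n"
proof (induction n rule: less_induct)
  case (less n)
  have \<rho>: "\<rho> \<ge> 0" using assms by linarith
  consider "n = 0" | "n = Suc 0" | m where "n = Suc (Suc m)"
    by (metis not0_implies_Suc)
  then show ?case
  proof cases
    case (3 m)
    let ?p = "\<lambda>k. legendre_hom k A B"
    let ?m = "real (Suc m)"
    have "(?m + 1) * \<bar>?p n\<bar> = \<bar>(2 * ?m + 1) * A * ?p (Suc m) - ?m * B\<^sup>2 * ?p m\<bar>"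
      using legendre_hom_rec[of "Suc m" A B] abs_mult[of "?m + 1" "?p n"] unfolding 3
      by simp
    also have "\<dots> \<le> \<bar>(2 * ?m + 1) * A * ?p (Suc m)\<bar> + \<bar>?m * B\<^sup>2 * ?p m\<bar>"
      by (rule abs_triangle_ineq4)
    also have "\<dots> = (2 * ?m + 1) * (\<bar>A\<bar> * \<bar>?p (Suc m)\<bar>) + ?m * (\<bar>B\<bar>\<^sup>2 * \<bar>?p m\<bar>)"
      by (simp add: abs_mult)
    also have "\<dots> \<le> (2 * ?m + 1) * (\<rho> * (3 * \<rho>) ^ Suc m) + ?m * (\<rho>\<^sup>2 * (3 * \<rho>) ^ m)"
      using less[of "Suc m"] less[of m] assms 3 \<rho>
      by (intro add_mono mult_mono power_mono) auto
    also have "\<dots> = (7 * ?m + 3) * (\<rho>\<^sup>2 * (3 * \<rho>) ^ m)"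
      by (simp add: power2_eq_square algebra_simps)
    also have "\<dots> \<le> (9 * (?m + 1)) * (\<rho>\<^sup>2 * (3 * \<rho>) ^ m)"
      using \<rho> by (intro mult_right_mono) auto
    also have "\<dots> = (?m + 1) * (3 * \<rho>) ^ n"
      by (simp add: 3 power2_eq_square)
    finally show ?thesis
      by (simp add: mult_le_cancel_left_pos)
  qed (use assms in auto)
qed

section \<open>The derivation x (1 - x^2) d/dx\<close>

text \<open>The elliptic equation has the self-adjoint form \<open>(x (1 - x\<^sup>2) h')' = x h\<close>, and \<open>x (1 - x\<^sup>2) h'\<close>
  is its flux. Multiplying once more by \<open>x (1 - x\<^sup>2)\<close>, both derivatives become applications of the
  same derivation. Its value at the singular point \<open>x = 1\<close> is \<open>0\<close> whatever the derivative is, so the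
  algebraic identities below hold there as well.\<close>
definition has_flux :: "(real \<Rightarrow> real) \<Rightarrow> real \<Rightarrow> real \<Rightarrow> bool" where
  "has_flux f D x \<longleftrightarrow>
     (\<exists>d. (f has_real_derivative d) (at x) \<and> D = x * (1 - x\<^sup>2) * d)"

lemma has_fluxI:
  "(f has_real_derivative d) (at x) \<Longrightarrow> D = x * (1 - x\<^sup>2) * d \<Longrightarrow> has_flux f D x"
  by (auto simp: has_flux_def)

lemma has_flux_cong: "has_flux f D x \<Longrightarrow> D = D' \<Longrightarrow> has_flux f D' x"
  by simp

lemma has_flux_imp_isCont: "has_flux f D x \<Longrightarrow> isCont f x"
  by (auto simp: has_flux_def intro: DERIV_isCont)

lemma has_flux_at_1: "has_flux f D 1 \<Longrightarrow> D = 0"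
  by (simp add: has_flux_def)

lemma has_flux_const: "has_flux (\<lambda>_. c) 0 x"
  by (rule has_fluxI[OF DERIV_const]) simp

lemma has_flux_add:
  "has_flux f D x \<Longrightarrow> has_flux g E x \<Longrightarrow> has_flux (\<lambda>x. f x + g x) (D + E) x"
  by (fastforce simp: has_flux_def distrib_left intro: DERIV_add)

lemma has_flux_diff:
  "has_flux f D x \<Longrightarrow> has_flux g E x \<Longrightarrow> has_flux (\<lambda>x. f x - g x) (D - E) x"
  by (fastforce simp: has_flux_def right_diff_distrib intro: DERIV_diff)

lemma has_flux_mult:
  assumes "has_flux f D x" "has_flux g E x"
  shows "has_flux (\<lambda>x. f x * g x) (D * g x + f x * E) x"
proof -
  obtain d e where "(f has_real_derivative d) (at x)" "D = x * (1 - x\<^sup>2) * d"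
    "(g has_real_derivative e) (at x)" "E = x * (1 - x\<^sup>2) * e"
    using assms by (auto simp: has_flux_def)
  then show ?thesis
    by (intro has_fluxI[OF DERIV_mult]) (auto simp only: ring_distribs mult_ac)
qed

lemma has_flux_cmult: "has_flux f D x \<Longrightarrow> has_flux (\<lambda>x. c * f x) (c * D) x"
  using has_flux_mult[OF has_flux_const[of c]] by simp

lemma has_flux_sum:
  "(\<And>i. i \<in> I \<Longrightarrow> has_flux (f i) (D i) x) \<Longrightarrow>
     has_flux (\<lambda>x. \<Sum>i\<in>I. f i x) (\<Sum>i\<in>I. D i) x"
  by (induction I rule: infinite_finite_induct)
    (simp_all add: has_flux_const has_flux_add)

text \<open>A vector field on the \<open>(A, B)\<close>-plane that scales by \<open>\<alpha>\<close> and boosts by \<open>\<gamma>\<close> acts on the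
  homogeneous Legendre polynomials within their span: scaling acts through the degree, and the boost
  \<open>B \<partial>/\<partial>A + A \<partial>/\<partial>B\<close> preserves \<open>A\<^sup>2 - B\<^sup>2\<close> and sends \<open>p\<^sub>n\<close> to \<open>n B p\<^sub>n\<^sub>-\<^sub>1\<close>. The induction
  runs along Bonnet's recurrence.\<close>
lemma has_flux_legendre_hom:
  assumes A: "has_flux A (\<alpha> * A x + \<gamma> * B x) x"
    and B: "has_flux B (\<alpha> * B x + \<gamma> * A x) x"
  shows "has_flux (\<lambda>x. legendre_hom n (A x) (B x))
    (real n * (\<alpha> * legendre_hom n (A x) (B x) + \<gamma> * B x * legendre_hom (n - 1) (A x) (B x))) x"
proof (induction n rule: less_induct)
  case (less n)
  consider "n = 0" | "n = Suc 0" | m where "n = Suc (Suc m)"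
    by (metis not0_implies_Suc)
  then show ?case
  proof cases
    case 1
    then show ?thesis by (simp add: has_flux_const)
  next
    case 2
    then show ?thesis using A by simp
  next
    case (3 m)
    define p where "p = (\<lambda>k x. legendre_hom k (A x) (B x))"
    define \<mu> where "\<mu> = real m"
    have p: "p n = (\<lambda>x. 1 / (\<mu> + 2) * ((2 * \<mu> + 3) * (A x * p (Suc m) x)
        - (\<mu> + 1) * ((B x * B x) * p m x)))"
    proof
      fix x
      have "(\<mu> + 2) * p n x = (2 * \<mu> + 3) * (A x * p (Suc m) x)
          - (\<mu> + 1) * ((B x * B x) * p m x)"
        using legendre_hom_rec[of "Suc m" "A x" "B x"]
        by (simp add: p_def 3 \<mu>_def power2_eq_square algebra_simps)
      moreover have "\<mu> + 2 \<noteq> 0" by (simp add: \<mu>_def add_nonneg_eq_0_iff)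
      ultimately show "p n x = 1 / (\<mu> + 2) * ((2 * \<mu> + 3) * (A x * p (Suc m) x)
          - (\<mu> + 1) * ((B x * B x) * p m x))"
        by (simp add: field_simps)
    qed
    have low: "\<mu> * B x ^ 2 * p (m - 1) x = (2 * \<mu> + 1) * A x * p m x - (\<mu> + 1) * p (Suc m) x"
      using legendre_hom_rec[of m "A x" "B x"] by (simp add: p_def \<mu>_def)
    have IH1: "has_flux (p (Suc m)) ((\<mu> + 1) * (\<alpha> * p (Suc m) x + \<gamma> * B x * p m x)) x"
      using less[of "Suc m"] 3 by (simp add: p_def \<mu>_def add.commute)
    have IH0: "has_flux (p m) (\<mu> * (\<alpha> * p m x + \<gamma> * B x * p (m - 1) x)) x"
      using less[of m] 3 by (simp add: p_def \<mu>_def)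
    have nz: "\<mu> + 2 \<noteq> 0" by (simp add: \<mu>_def add_nonneg_eq_0_iff)
    have pn: "(\<mu> + 2) * p n x = (2 * \<mu> + 3) * (A x * p (Suc m) x)
          - (\<mu> + 1) * ((B x * B x) * p m x)"
      using nz by (subst p) simp
    have "has_flux (p n) ((\<mu> + 2) * (\<alpha> * p n x + \<gamma> * B x * p (Suc m) x)) x"
    proof (rule has_flux_cong)
      let ?Dlow = "\<mu> * (\<alpha> * p m x + \<gamma> * B x * p (m - 1) x)"
      let ?Dhigh = "(\<mu> + 1) * (\<alpha> * p (Suc m) x + \<gamma> * B x * p m x)"
      let ?DA = "\<alpha> * A x + \<gamma> * B x" and ?DB = "\<alpha> * B x + \<gamma> * A x"
      let ?D = "1 / (\<mu> + 2) * ((2 * \<mu> + 3) * (?DA * p (Suc m) x + A x * ?Dhigh)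
          - (\<mu> + 1) * ((?DB * B x + B x * ?DB) * p m x + B x * B x * ?Dlow))"
      show "has_flux (p n) ?D x"
        by (subst p) (intro has_flux_cmult has_flux_diff has_flux_mult A B IH0 IH1)
      have cancel: "(\<mu> + 2) * (1 / (\<mu> + 2) * Z) = Z" for Z
        using nz by simp
      have "(\<mu> + 2) * ?D = (2 * \<mu> + 3) * (?DA * p (Suc m) x + A x * ?Dhigh)
          - (\<mu> + 1) * ((?DB * B x + B x * ?DB) * p m x + B x * B x * ?Dlow)"
        by (rule cancel)
      also have "\<dots> = (2 * \<mu> + 3) * (?DA * p (Suc m) x + A x * ?Dhigh)
          - (\<mu> + 1) * ((?DB * B x + B x * ?DB + B x * B x * \<mu> * \<alpha>) * p m x
              + \<gamma> * B x * (\<mu> * B x ^ 2 * p (m - 1) x))"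
        by (simp add: algebra_simps power2_eq_square)
      also have "\<dots> = (\<mu> + 2) * ((\<mu> + 2) * (\<alpha> * p n x + \<gamma> * B x * p (Suc m) x))"
      proof -
        have "(\<mu> + 2) * ((\<mu> + 2) * (\<alpha> * p n x + \<gamma> * B x * p (Suc m) x)) =
            (\<mu> + 2) * (\<alpha> * ((\<mu> + 2) * p n x) + \<gamma> * B x * ((\<mu> + 2) * p (Suc m) x))"
          by (simp only: ring_distribs mult_ac)
        then show ?thesis
          unfolding low pn by (simp add: algebra_simps power2_eq_square)
      qed
      finally show "?D = (\<mu> + 2) * (\<alpha> * p n x + \<gamma> * B x * p (Suc m) x)"
        by (rule mult_left_cancel[OF nz, THEN iffD1])
    qed
    then show ?thesis by (simp add: p_def 3 \<mu>_def add.commute)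
  qed
qed

section \<open>The hypergeometric solution of the complementary elliptic equation\<close>

text \<open>These are the coefficients of \<open>\<^sub>2F\<^sub>1(1/2, 1/2; 1; z)\<close>, equal to \<open>(2n choose n)\<^sup>2 / 16\<^sup>n\<close>; they
  are at the same time the weights of the Legendre series.\<close>
definition central_weight :: "nat \<Rightarrow> real" where
  "central_weight n = (pochhammer (1/2) n)\<^sup>2 / (fact n)\<^sup>2"

lemma central_weight_0 [simp]: "central_weight 0 = 1"
  by (simp add: central_weight_def)

lemma central_weight_Suc:
  "(real n + 1)\<^sup>2 * central_weight (Suc n) = (real n + 1/2)\<^sup>2 * central_weight n"
proof -
  have "real n + 1 \<noteq> 0" by simp
  then show ?thesis
    by (simp add: central_weight_def pochhammer_Suc power_mult_distrib add_ac)
qed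

lemma central_weight_nonneg: "0 \<le> central_weight n"
  by (simp add: central_weight_def)

lemma central_weight_le_1: "central_weight n \<le> 1"
proof (induction n)
  case (Suc n)
  have "(real n + 1)\<^sup>2 * central_weight (Suc n) = (real n + 1/2)\<^sup>2 * central_weight n"
    by (rule central_weight_Suc)
  also have "\<dots> \<le> (real n + 1)\<^sup>2 * 1"
    using Suc central_weight_nonneg[of n] by (intro mult_mono power_mono) auto
  finally show ?case
    by (simp add: mult_le_cancel_left_pos)
qed simp

lemma hypergeo_half_nth: "fps_nth (fps_hypergeo [1/2, 1/2] [1] 1) n = central_weight n"
  by (simp add: central_weight_def power2_eq_square pochhammer_fact[symmetric])

lemma hypergeo_half_conv_radius: "1 \<le> fps_conv_radius (fps_hypergeo [1/2, 1/2] [1::real] 1)"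
  unfolding fps_conv_radius_def hypergeo_half_nth
proof (rule conv_radius_geI_ex')
  fix r :: real assume "0 < r" "ereal r < 1"
  then show "summable (\<lambda>n. central_weight n * of_real r ^ n)"
    using central_weight_nonneg central_weight_le_1
    by (intro summable_comparison_test'[OF summable_geometric[of r], of 0])
       (auto simp: abs_mult intro!: mult_left_le_one_le)
qed

text \<open>The hypergeometric equation \<open>(z (1 - z) f')' = f / 4\<close>. Its coefficient form is the recurrence
  of the weights, because \<open>(n + 1/2)\<^sup>2 - n (n + 1) = 1/4\<close>.\<close>
lemma hypergeo_half_ode:
  fixes f :: "real fps"
  defines "f \<equiv> fps_hypergeo [1/2, 1/2] [1] 1"
  shows "fps_deriv (fps_X * (fps_deriv f - fps_X * fps_deriv f)) = fps_const (1/4) * f"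
proof (rule fps_ext)
  fix n
  have "(real n + 1)\<^sup>2 * central_weight (Suc n) - (real n + 1) * (real n * central_weight n)
      = central_weight n / 4"
    unfolding central_weight_Suc by (simp add: power2_eq_square field_simps)
  then show "fps_nth (fps_deriv (fps_X * (fps_deriv f - fps_X * fps_deriv f))) n =
      fps_nth (fps_const (1/4) * f) n"
    unfolding f_def
    by (cases n) (simp_all add: hypergeo_half_nth power2_eq_square algebra_simps
        del: fps_hypergeo_nth)
qed

text \<open>The complementary elliptic integral \<open>K(\<surd>(1 - x\<^sup>2))\<close> divided by \<open>\<pi>/2\<close>. Unlike the integral
  itself, which takes a modulus, it is analytic across \<open>x = 1\<close>.\<close>
definition ellK_compl :: "real \<Rightarrow> real" where
  "ellK_compl x = hyp2f1 (1/2) (1/2) 1 (1 - x\<^sup>2)"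

lemma ellK_compl_1 [simp]: "ellK_compl 1 = 1"
  by (simp add: ellK_compl_def hyp2f1_def eval_fps_at_0)

text \<open>With \<open>z = 1 - x\<^sup>2\<close> one has \<open>x (1 - x\<^sup>2) d/dx = - 2 z (1 - z) d/dz\<close>.\<close>
definition ellK_compl_flux :: "real \<Rightarrow> real" where
  "ellK_compl_flux x =
     - 2 * eval_fps (fps_X * (fps_deriv (fps_hypergeo [1/2, 1/2] [1] 1)
        - fps_X * fps_deriv (fps_hypergeo [1/2, 1/2] [1] 1))) (1 - x\<^sup>2)"

lemma ellK_compl_ode:
  assumes "\<bar>1 - x\<^sup>2\<bar> < 1"
  shows "has_flux ellK_compl (ellK_compl_flux x) x"
    and "has_flux ellK_compl_flux (x * (1 - x\<^sup>2) * (x * ellK_compl x)) x"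
proof -
  define f :: "real fps" where "f = fps_hypergeo [1/2, 1/2] [1] 1"
  define h where "h = fps_X * (fps_deriv f - fps_X * fps_deriv f)"
  define z where "z = 1 - x\<^sup>2"
  have f: "ereal (norm z) < fps_conv_radius f"
  proof -
    have "ereal (norm z) < 1" using assms by (simp add: z_def)
    then show ?thesis
      using hypergeo_half_conv_radius unfolding f_def by (rule less_le_trans)
  qed
  then have f': "ereal (norm z) < fps_conv_radius (fps_deriv f)"
    by (rule less_le_trans[OF _ fps_conv_radius_deriv])
  then have Xf': "ereal (norm z) < fps_conv_radius (fps_X * fps_deriv f)"
    by (intro less_le_trans[OF _ fps_conv_radius_mult]) auto
  with f' have df: "ereal (norm z) < fps_conv_radius (fps_deriv f - fps_X * fps_deriv f)"
    by (intro less_le_trans[OF _ fps_conv_radius_diff]) auto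
  then have h: "ereal (norm z) < fps_conv_radius h"
    unfolding h_def by (intro less_le_trans[OF _ fps_conv_radius_mult]) auto
  have h_eval: "eval_fps h z = z * (1 - z) * eval_fps (fps_deriv f) z"
    using f' Xf' df unfolding h_def
    by (simp add: eval_fps_mult eval_fps_diff) (simp add: algebra_simps)
  have h'_eval: "eval_fps (fps_deriv h) z = eval_fps f z / 4"
    using hypergeo_half_ode f by (simp add: h_def f_def eval_fps_mult)
  have z: "((\<lambda>x. 1 - x\<^sup>2) has_real_derivative - 2 * x) (at x)"
    by (auto intro!: derivative_eq_intros)
  note chain = DERIV_chain2[OF has_field_derivative_eval_fps z, folded z_def]
  have "(ellK_compl has_real_derivative eval_fps (fps_deriv f) z * (- 2 * x)) (at x)"
    using chain[OF f] unfolding ellK_compl_def hyp2f1_def f_def by simp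
  then show "has_flux ellK_compl (ellK_compl_flux x) x"
    by (rule has_fluxI)
      (use h_eval in \<open>simp add: ellK_compl_flux_def h_def f_def z_def power2_eq_square\<close>)
  have "(ellK_compl_flux has_real_derivative - 2 * (eval_fps (fps_deriv h) z * (- 2 * x))) (at x)"
    unfolding ellK_compl_flux_def f_def[symmetric] h_def[symmetric]
    using chain[OF h] by (intro DERIV_cmult)
  then show "has_flux ellK_compl_flux (x * (1 - x\<^sup>2) * (x * ellK_compl x)) x"
    by (rule has_fluxI) (simp add: h'_eval ellK_compl_def hyp2f1_def flip: f_def z_def)
qed

section \<open>Uniqueness at the singular point\<close>

text \<open>The mean value theorem uses derivatives at interior points only, so the end point \<open>c\<close> may be
  exempted. Below, \<open>c = 1\<close> is the singular point, where the flux says nothing about a derivative.\<close>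
lemma abs_diff_le_punctured:
  fixes f :: "real \<Rightarrow> real"
  assumes cont: "\<And>t. t \<in> closed_segment c x \<Longrightarrow> isCont f t"
    and deriv: "\<And>t. t \<in> closed_segment c x \<Longrightarrow> t \<noteq> c \<Longrightarrow>
      \<exists>d. (f has_real_derivative d) (at t) \<and> \<bar>d\<bar> \<le> K"
  shows "\<bar>f x - f c\<bar> \<le> K * \<bar>x - c\<bar>"
proof -
  define a where "a = min c x"
  define b where "b = max c x"
  have seg: "closed_segment c x = {a..b}"
    by (simp add: a_def b_def closed_segment_eq_real_ivl min_def max_def)
  have main: "\<bar>f b - f a\<bar> \<le> K * \<bar>b - a\<bar>" if "a < b"
  proof -
    have ne: "t \<noteq> c" if "a < t" "t < b" for t
      using that by (auto simp: a_def b_def)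
    have "\<exists>l z. a < z \<and> z < b \<and> DERIV f z :> l \<and> f b - f a = (b - a) * l"
    proof (rule MVT[OF that])
      show "continuous_on {a..b} f"
        using cont unfolding seg by (intro continuous_at_imp_continuous_on) auto
      show "f differentiable (at t)" if "a < t" "t < b" for t
        using deriv[of t] ne[OF that] that unfolding seg
        by (auto simp: real_differentiable_def)
    qed
    then obtain l z where z: "a < z" "z < b" "DERIV f z :> l" "f b - f a = (b - a) * l"
      by blast
    obtain d where "DERIV f z :> d" "\<bar>d\<bar> \<le> K"
      using deriv[of z] ne[of z] z unfolding seg by auto
    then have "\<bar>l\<bar> \<le> K"
      using DERIV_unique[OF z(3)] by auto
    then show ?thesis
      unfolding z(4) abs_mult by (subst mult.commute) (intro mult_right_mono, auto)
  qed
  show ?thesis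
  proof (cases "c = x")
    case False
    then have "a < b" by (auto simp: a_def b_def)
    with main show ?thesis
      unfolding a_def b_def by (cases "c \<le> x") (auto simp: min_def max_def abs_minus_commute)
  qed simp
qed

lemma has_flux_imp_deriv:
  assumes "has_flux f D t" "0 < t" "t \<noteq> 1"
  shows "(f has_real_derivative D / (t * (1 - t\<^sup>2))) (at t)"
proof -
  have "t * (1 - t\<^sup>2) \<noteq> 0"
    using assms by (auto simp: power2_eq_1_iff)
  then show ?thesis
    using assms(1) unfolding has_flux_def by auto
qed

text \<open>The local exponents of the elliptic equation at \<open>x = 1\<close> are both \<open>0\<close>, the second solution being
  logarithmic, so a solution regular there is determined by its value at \<open>1\<close>. The estimate is a
  quantitative form of this for an approximate solution \<open>h\<close> with residual \<open>r\<close>. The Wronskian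
  \<open>W = x (1 - x\<^sup>2) (h' g - h g')\<close> vanishes at \<open>1\<close> and has derivative \<open>r g\<close>, so \<open>\<bar>W x\<bar>\<close> is at most
  of order \<open>\<epsilon> \<bar>x - 1\<bar>\<close>. This cancels the simple zero of \<open>x (1 - x\<^sup>2)\<close>, and
  \<open>(h / g)' = W / (x (1 - x\<^sup>2) g\<^sup>2)\<close> is of order \<open>\<epsilon>\<close>. Working with residuals allows an application
  to the partial sums of a series, so that only finite sums are ever differentiated.\<close>
lemma wronskian_estimate:
  assumes \<delta>: "\<delta> \<le> 1/20" and x: "\<bar>x - 1\<bar> < \<delta>"
    and g: "\<And>t. \<bar>t - 1\<bar> < \<delta> \<Longrightarrow> has_flux g (G t) t"
    and G: "\<And>t. \<bar>t - 1\<bar> < \<delta> \<Longrightarrow> has_flux G (t * (1 - t\<^sup>2) * (t * g t)) t"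
    and g_bounds: "\<And>t. \<bar>t - 1\<bar> < \<delta> \<Longrightarrow> 1/2 < g t \<and> g t < 2"
    and h: "\<And>t. \<bar>t - 1\<bar> < \<delta> \<Longrightarrow> has_flux h (E t) t"
    and E: "\<And>t. \<bar>t - 1\<bar> < \<delta> \<Longrightarrow> has_flux E (t * (1 - t\<^sup>2) * (t * h t + r t)) t"
    and r: "\<And>t. \<bar>t - 1\<bar> < \<delta> \<Longrightarrow> \<bar>r t\<bar> \<le> \<epsilon>"
  shows "\<bar>h x / g x - h 1 / g 1\<bar> \<le> 8 * \<epsilon>"
proof -
  have \<delta>0: "\<delta> > 0" using x by linarith
  have near: "\<bar>s - 1\<bar> < \<delta>" if "s \<in> closed_segment 1 t" "\<bar>t - 1\<bar> < \<delta>" for s t :: real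
    using that by (auto simp: closed_segment_eq_real_ivl split: if_splits)
  have pos: "0 < t" if "\<bar>t - 1\<bar> < \<delta>" for t
    using that \<delta> by linarith
  have \<epsilon>: "\<epsilon> \<ge> 0" using r[OF x] by linarith
  define W where "W = (\<lambda>t. E t * g t - h t * G t)"
  have W: "has_flux W (t * (1 - t\<^sup>2) * (r t * g t)) t" if "\<bar>t - 1\<bar> < \<delta>" for t
    unfolding W_def
    by (rule has_flux_cong[OF has_flux_diff[OF has_flux_mult[OF E[OF that] g[OF that]]
            has_flux_mult[OF h[OF that] G[OF that]]]])
       (simp add: algebra_simps)
  have "W 1 = 0"
    using has_flux_at_1[OF h[of 1]] has_flux_at_1[OF g[of 1]] \<delta>0 by (simp add: W_def)
  have W_le: "\<bar>W t\<bar> \<le> 2 * \<epsilon> * \<bar>t - 1\<bar>" if t: "\<bar>t - 1\<bar> < \<delta>" for t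
  proof -
    have "\<bar>W t - W 1\<bar> \<le> (2 * \<epsilon>) * \<bar>t - 1\<bar>"
    proof (rule abs_diff_le_punctured)
      fix s assume "s \<in> closed_segment 1 t"
      then have s: "\<bar>s - 1\<bar> < \<delta>" using near t by blast
      show "isCont W s" using has_flux_imp_isCont[OF W[OF s]] .
      assume "s \<noteq> 1"
      then have "s * (1 - s\<^sup>2) \<noteq> 0"
        using pos[OF s] by (auto simp: power2_eq_1_iff)
      then have "(W has_real_derivative r s * g s) (at s)"
        using has_flux_imp_deriv[OF W[OF s] pos[OF s] \<open>s \<noteq> 1\<close>] by simp
      moreover have "\<bar>r s * g s\<bar> \<le> \<epsilon> * 2"
        unfolding abs_mult using r[OF s] g_bounds[OF s] by (intro mult_mono) auto
      ultimately show "\<exists>d. (W has_real_derivative d) (at s) \<and> \<bar>d\<bar> \<le> 2 * \<epsilon>"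
        by (auto simp: mult.commute)
    qed
    then show ?thesis using \<open>W 1 = 0\<close> by simp
  qed
  have "\<bar>h x / g x - h 1 / g 1\<bar> \<le> (8 * \<epsilon>) * \<bar>x - 1\<bar>"
  proof (rule abs_diff_le_punctured[where f = "\<lambda>t. h t / g t"])
    fix t assume "t \<in> closed_segment 1 x"
    then have t: "\<bar>t - 1\<bar> < \<delta>" using near x by blast
    have g0: "g t > 1/2" using g_bounds[OF t] by simp
    show "isCont (\<lambda>t. h t / g t) t"
      using has_flux_imp_isCont[OF h[OF t]] has_flux_imp_isCont[OF g[OF t]] g0
      by (intro continuous_divide) auto
    assume "t \<noteq> 1"
    define p where "p = t * (1 - t\<^sup>2)"
    have p: "\<bar>p\<bar> \<ge> \<bar>t - 1\<bar>"
    proof -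
      have "p = - ((t * (1 + t)) * (t - 1))"
        by (simp add: p_def power2_eq_square algebra_simps)
      then have "\<bar>p\<bar> = (t * (1 + t)) * \<bar>t - 1\<bar>"
        using pos[OF t] by (simp add: abs_mult)
      moreover have "1 \<le> t * (1 + t)"
      proof -
        have "19/20 * (1 + 19/20) \<le> t * (1 + t)"
          using t \<delta> by (intro mult_mono) auto
        then show ?thesis by simp
      qed
      ultimately show ?thesis
        using mult_right_mono[of 1 "t * (1 + t)" "\<bar>t - 1\<bar>"] by simp
    qed
    then have p0: "p \<noteq> 0" using \<open>t \<noteq> 1\<close> by auto
    have "((\<lambda>t. h t / g t) has_real_derivative (E t / p * g t - h t * (G t / p)) / (g t * g t)) (at t)"
      using has_flux_imp_deriv[OF h[OF t] pos[OF t] \<open>t \<noteq> 1\<close>]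
        has_flux_imp_deriv[OF g[OF t] pos[OF t] \<open>t \<noteq> 1\<close>] g0
      unfolding p_def by (intro DERIV_divide) auto
    also have "(E t / p * g t - h t * (G t / p)) / (g t * g t) = W t / (p * (g t * g t))"
      using p0 g0 by (simp add: W_def field_simps)
    finally have "((\<lambda>t. h t / g t) has_real_derivative W t / (p * (g t * g t))) (at t)" .
    moreover have "\<bar>W t / (p * (g t * g t))\<bar> \<le> 8 * \<epsilon>"
    proof -
      have "1/2 * (1/2) \<le> g t * g t"
        using g0 by (intro mult_mono) auto
      then have "\<bar>t - 1\<bar> * (1/4) \<le> \<bar>p\<bar> * (g t * g t)"
        using p by (intro mult_mono) auto
      then have "8 * \<epsilon> * (\<bar>t - 1\<bar> * (1/4)) \<le> 8 * \<epsilon> * (\<bar>p\<bar> * (g t * g t))"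
        using \<epsilon> by (intro mult_left_mono) auto
      then have "\<bar>W t\<bar> \<le> 8 * \<epsilon> * \<bar>p * (g t * g t)\<bar>"
        using W_le[OF t] by (simp add: abs_mult)
      moreover have "\<bar>p * (g t * g t)\<bar> > 0" using p0 g0 by simp
      ultimately show ?thesis
        by (simp only: abs_divide pos_divide_le_eq)
    qed
    ultimately show "\<exists>d. ((\<lambda>t. h t / g t) has_real_derivative d) (at t) \<and> \<bar>d\<bar> \<le> 8 * \<epsilon>"
      by blast
  qed
  also have "\<dots> \<le> 8 * \<epsilon> * 1"
    using \<epsilon> x \<delta> by (intro mult_left_mono) auto
  finally show ?thesis by simp
qed

lemma ellK_compl_bounds_near_1:
  obtains \<delta> where "0 < \<delta>" "\<delta> \<le> 1/20"
    "\<And>t. \<bar>t - 1\<bar> < \<delta> \<Longrightarrow> 1/2 < ellK_compl t \<and> ellK_compl t < 2"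
proof -
  have "isCont ellK_compl 1"
    using has_flux_imp_isCont[OF ellK_compl_ode(1)[of 1]] by simp
  then obtain d where d: "d > 0" "\<And>t. \<bar>t - 1\<bar> < d \<Longrightarrow> \<bar>ellK_compl t - 1\<bar> < 1/2"
    unfolding continuous_at_eps_delta dist_real_def
    by (metis ellK_compl_1 half_gt_zero zero_less_one)
  show ?thesis
  proof (rule that[of "min d (1/20)"])
    fix t :: real assume "\<bar>t - 1\<bar> < min d (1/20)"
    then have "\<bar>ellK_compl t - 1\<bar> < 1/2" using d(2)[of t] by simp
    then show "1/2 < ellK_compl t \<and> ellK_compl t < 2" by (auto simp: abs_if split: if_splits)
  qed (use d in auto)
qed

lemma near_1_square_bound:
  assumes "\<bar>t - 1\<bar> < 1/10"
  shows "\<bar>1 - t\<^sup>2\<bar> < (1::real)"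
proof -
  have t: "0 < t" "t < 11/10" using assms by (auto simp: abs_if split: if_splits)
  then have "t\<^sup>2 < (11/10)\<^sup>2" by (intro power_strict_mono) auto
  with t have "t\<^sup>2 < 2" "0 < t\<^sup>2" by (simp_all add: power2_eq_square)
  then show ?thesis by (auto simp: abs_if)
qed

section \<open>Pfaff's transformation\<close>

lemma has_flux_inverse_arg:
  assumes "has_flux f D (1 / x)" "x \<noteq> 0"
  shows "has_flux (\<lambda>x. f (1 / x)) (x\<^sup>2 * D) x"
proof -
  obtain d where d: "(f has_real_derivative d) (at (1 / x))" "D = 1 / x * (1 - (1 / x)\<^sup>2) * d"
    using assms(1) by (auto simp: has_flux_def)
  have "((\<lambda>x. 1 / x) has_real_derivative - 1 / x\<^sup>2) (at x)"
    using assms(2) by (auto intro!: derivative_eq_intros simp: power2_eq_square)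
  from has_fluxI[OF DERIV_chain2[OF d(1) this]] show ?thesis
    using assms(2) by (simp add: d(2) field_simps power2_eq_square)
qed

text \<open>Pfaff's transformation of \<open>\<^sub>2F\<^sub>1(1/2, 1/2; 1; z)\<close>. The elliptic equation is invariant under
  \<open>h x \<mapsto> h (1 / x) / x\<close>, and both sides take the value \<open>1\<close> at \<open>x = 1\<close>, so uniqueness identifies
  them.\<close>
lemma ellK_compl_inverse:
  assumes \<delta>: "\<delta> \<le> 1/20" and x: "\<bar>x - 1\<bar> < \<delta>"
    and bounds: "\<And>t. \<bar>t - 1\<bar> < \<delta> \<Longrightarrow> 1/2 < ellK_compl t \<and> ellK_compl t < 2"
  shows "ellK_compl (1 / x) * (1 / x) = ellK_compl x"
proof -
  define h where "h = (\<lambda>t. ellK_compl (1 / t) * (1 / t))"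
  define E where "E = (\<lambda>t. t * ellK_compl_flux (1 / t) - (1 / t - t) * ellK_compl (1 / t))"
  have near: "\<bar>t - 1\<bar> < 1/10" "\<bar>1 / t - 1\<bar> < 1/10" "t > 0" if "\<bar>t - 1\<bar> < \<delta>" for t
  proof -
    have t: "19/20 < t" "t < 21/20" using that \<delta> by linarith+
    then show "t > 0" "\<bar>t - 1\<bar> < 1/10" by linarith+
    from t have "1 / t < 1 + 1/10" "1 / t > 1 - 1/10" by (simp_all add: field_simps)
    then show "\<bar>1 / t - 1\<bar> < 1/10" by linarith
  qed
  have h: "has_flux h (E t) t" if t: "\<bar>t - 1\<bar> < \<delta>" for t
  proof -
    have "t \<noteq> 0" using near[OF t] by simp
    have inv: "has_flux (\<lambda>t. 1 / t) (t - 1 / t) t"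
      using \<open>t \<noteq> 0\<close>
      by (intro has_fluxI[where d = "- 1 / t\<^sup>2"])
         (auto intro!: derivative_eq_intros simp: power2_eq_square field_simps)
    have g: "has_flux (\<lambda>t. ellK_compl (1 / t)) (t\<^sup>2 * ellK_compl_flux (1 / t)) t"
      using near[OF t] by (intro has_flux_inverse_arg ellK_compl_ode near_1_square_bound) auto
    show ?thesis
      unfolding h_def E_def using \<open>t \<noteq> 0\<close>
      by (rule_tac has_flux_cong[OF has_flux_mult[OF g inv]])
         (simp add: field_simps power2_eq_square)
  qed
  have E: "has_flux E (t * (1 - t\<^sup>2) * (t * h t + 0)) t" if t: "\<bar>t - 1\<bar> < \<delta>" for t
  proof -
    have "t \<noteq> 0" using near[OF t] by simp
    have idt: "has_flux (\<lambda>t. t) (t * (1 - t\<^sup>2)) t"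
      by (rule has_fluxI[OF DERIV_ident]) simp
    have inv: "has_flux (\<lambda>t. 1 / t - t) (t * (1 - t\<^sup>2) * (- 1 / t\<^sup>2 - 1)) t"
      using \<open>t \<noteq> 0\<close>
      by (intro has_fluxI[OF _ refl])
         (auto intro!: derivative_eq_intros simp: power2_eq_square field_simps)
    have g: "has_flux (\<lambda>t. ellK_compl (1 / t)) (t\<^sup>2 * ellK_compl_flux (1 / t)) t"
      using near[OF t] by (intro has_flux_inverse_arg ellK_compl_ode near_1_square_bound) auto
    have G: "has_flux (\<lambda>t. ellK_compl_flux (1 / t))
        (t\<^sup>2 * (1 / t * (1 - (1 / t)\<^sup>2) * (1 / t * ellK_compl (1 / t)))) t"
      using near[OF t] by (intro has_flux_inverse_arg ellK_compl_ode near_1_square_bound) auto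
    show ?thesis
      unfolding h_def E_def using \<open>t \<noteq> 0\<close>
      by (rule_tac has_flux_cong[OF has_flux_diff[OF has_flux_mult[OF idt G] has_flux_mult[OF inv g]]])
         (simp add: field_simps power2_eq_square)
  qed
  have "\<bar>h x / ellK_compl x - h 1 / ellK_compl 1\<bar> \<le> 8 * 0"
    by (rule wronskian_estimate[OF \<delta> x _ _ bounds h E])
       (auto intro!: ellK_compl_ode near_1_square_bound near)
  moreover have "h 1 / ellK_compl 1 = 1" by (simp add: h_def)
  ultimately have "h x / ellK_compl x = 1" by linarith
  then have "h x = ellK_compl x"
    using bounds[OF x] by (simp only: divide_eq_1_iff)
  then show ?thesis by (simp only: h_def)
qed

section \<open>The complementary elliptic operator on one Legendre term\<close>

text \<open>The arguments satisfy \<open>A - B = 2 y (1 - x\<^sup>2) / (1 + x y)\<^sup>2\<close> and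
  \<open>A + B = 2 x (1 - y\<^sup>2) / (1 + x y)\<^sup>2\<close>.\<close>
definition arg_A :: "real \<Rightarrow> real \<Rightarrow> real" where
  "arg_A x y = (x + y) * (1 - x*y) / (1 + x*y)\<^sup>2"

definition arg_B :: "real \<Rightarrow> real \<Rightarrow> real" where
  "arg_B x y = (x - y) / (1 + x*y)"

text \<open>By the product formulas for \<open>A \<plusminus> B\<close>, the derivation acts on \<open>A + B\<close> and \<open>A - B\<close> by
  multiplication with logarithmic derivatives \<open>\<alpha> + \<gamma>\<close> and \<open>\<alpha> - \<gamma>\<close>. Here \<open>\<alpha>\<close> is \<open>rate_scale\<close>
  and \<open>\<gamma>\<close> is \<open>rate_boost\<close>; \<open>rate_prefactor\<close> is the logarithmic derivative of \<open>1 / (1 + x y)\<close>.\<close>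
definition rate_scale :: "real \<Rightarrow> real \<Rightarrow> real" where
  "rate_scale x y = (1 - 3*x\<^sup>2 - 3*x*y + x^3*y) / (2 * (1 + x*y))"

definition rate_boost :: "real \<Rightarrow> real" where
  "rate_boost x = (1 + x\<^sup>2) / 2"

definition rate_prefactor :: "real \<Rightarrow> real \<Rightarrow> real" where
  "rate_prefactor x y = - (x * (1 - x\<^sup>2)) * y / (1 + x*y)"

context
  fixes x y :: real
  assumes nz: "1 + x*y \<noteq> 0"
begin

lemma has_flux_arg_A:
  "has_flux (\<lambda>x. arg_A x y) (rate_scale x y * arg_A x y + rate_boost x * arg_B x y) x"
proof (rule has_fluxI)
  show "((\<lambda>x. arg_A x y) has_real_derivative
     (1 - 2*x*y - y\<^sup>2) / (1 + x*y)\<^sup>2 - 2 * y * (x + y) * (1 - x*y) / (1 + x*y)^3) (at x)"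
    unfolding arg_A_def using nz
    by (auto intro!: derivative_eq_intros simp: divide_simps) algebra
  show "rate_scale x y * arg_A x y + rate_boost x * arg_B x y = x * (1 - x\<^sup>2) *
     ((1 - 2*x*y - y\<^sup>2) / (1 + x*y)\<^sup>2 - 2 * y * (x + y) * (1 - x*y) / (1 + x*y)^3)"
    unfolding arg_A_def arg_B_def rate_scale_def rate_boost_def using nz
    by (simp add: divide_simps) algebra
qed

lemma has_flux_arg_B:
  "has_flux (\<lambda>x. arg_B x y) (rate_scale x y * arg_B x y + rate_boost x * arg_A x y) x"
proof (rule has_fluxI)
  show "((\<lambda>x. arg_B x y) has_real_derivative (1 + y\<^sup>2) / (1 + x*y)\<^sup>2) (at x)"
    unfolding arg_B_def using nz
    by (auto intro!: derivative_eq_intros simp: divide_simps) algebra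
  show "rate_scale x y * arg_B x y + rate_boost x * arg_A x y =
     x * (1 - x\<^sup>2) * ((1 + y\<^sup>2) / (1 + x*y)\<^sup>2)"
    unfolding arg_A_def arg_B_def rate_scale_def rate_boost_def using nz
    by (simp add: divide_simps) algebra
qed

lemma has_flux_prefactor:
  "has_flux (\<lambda>x. 1 / (1 + x*y)) (rate_prefactor x y * (1 / (1 + x*y))) x"
proof (rule has_fluxI)
  show "((\<lambda>x. 1 / (1 + x*y)) has_real_derivative - y / (1 + x*y)\<^sup>2) (at x)"
    using nz by (auto intro!: derivative_eq_intros simp: divide_simps power2_eq_square)
  show "rate_prefactor x y * (1 / (1 + x*y)) = x * (1 - x\<^sup>2) * (- y / (1 + x*y)\<^sup>2)"
    unfolding rate_prefactor_def by (simp add: power2_eq_square)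
qed

text \<open>The derivatives of the three rates are expressed through \<open>A\<close>, \<open>B\<close> and the rates themselves. The
  quadratic terms are the ones that cancel when the derivation is applied twice to a term of the
  series.\<close>
lemma has_flux_rate_prefactor:
  "has_flux (\<lambda>x. rate_prefactor x y)
     (x * (1 - x\<^sup>2) * (x - arg_A x y) - (rate_prefactor x y)\<^sup>2) x"
proof (rule has_fluxI)
  show "((\<lambda>x. rate_prefactor x y) has_real_derivative
     - y * ((1 - 3*x\<^sup>2) * (1 + x*y) - x * (1 - x\<^sup>2) * y) / (1 + x*y)\<^sup>2) (at x)"
    unfolding rate_prefactor_def using nz
    by (auto intro!: derivative_eq_intros simp: divide_simps) algebra
  show "x * (1 - x\<^sup>2) * (x - arg_A x y) - (rate_prefactor x y)\<^sup>2 = x * (1 - x\<^sup>2) *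
     (- y * ((1 - 3*x\<^sup>2) * (1 + x*y) - x * (1 - x\<^sup>2) * y) / (1 + x*y)\<^sup>2)"
    unfolding arg_A_def rate_prefactor_def using nz
    by (simp add: divide_simps) algebra
qed

lemma has_flux_rate_boost:
  "has_flux rate_boost
     (x * (1 - x\<^sup>2) * arg_B x y - 2 * rate_prefactor x y * rate_boost x) x"
proof (rule has_fluxI)
  show "(rate_boost has_real_derivative x) (at x)"
    unfolding rate_boost_def by (auto intro!: derivative_eq_intros)
  show "x * (1 - x\<^sup>2) * arg_B x y - 2 * rate_prefactor x y * rate_boost x = x * (1 - x\<^sup>2) * x"
    unfolding arg_B_def rate_prefactor_def rate_boost_def using nz
    by (simp add: divide_simps) algebra
qed

lemma has_flux_rate_scale:
  "has_flux (\<lambda>x. rate_scale x y)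
     (- 3 * (x * (1 - x\<^sup>2)) * arg_A x y - 2 * rate_prefactor x y * rate_scale x y) x"
proof (rule has_fluxI)
  show "((\<lambda>x. rate_scale x y) has_real_derivative
     ((- 6*x - 3*y + 3*x\<^sup>2*y) * (1 + x*y) - y * (1 - 3*x\<^sup>2 - 3*x*y + x^3*y))
       / (2 * (1 + x*y)\<^sup>2)) (at x)"
    unfolding rate_scale_def using nz
    by (auto intro!: derivative_eq_intros simp: divide_simps) algebra
  show "- 3 * (x * (1 - x\<^sup>2)) * arg_A x y - 2 * rate_prefactor x y * rate_scale x y =
     x * (1 - x\<^sup>2) *
     (((- 6*x - 3*y + 3*x\<^sup>2*y) * (1 + x*y) - y * (1 - 3*x\<^sup>2 - 3*x*y + x^3*y))
       / (2 * (1 + x*y)\<^sup>2))"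
    unfolding arg_A_def rate_prefactor_def rate_scale_def using nz
    by (simp add: divide_simps) algebra
qed

text \<open>The next two identities provide the factor \<open>x (1 - x\<^sup>2)\<close> in the part of the second derivative
  that is quadratic in the degree. For the first one, \<open>\<alpha> + \<gamma>\<close> is divisible by \<open>1 - x\<^sup>2\<close> and
  \<open>\<alpha> - \<gamma>\<close> by \<open>x\<close>.\<close>
lemma rate_scale_boost_squares:
  "(rate_scale x y)\<^sup>2 - (rate_boost x)\<^sup>2 = - 2 * (x * (1 - x\<^sup>2)) * arg_A x y"
  unfolding arg_A_def rate_scale_def rate_boost_def using nz
  by (simp add: divide_simps) algebra

lemma rate_boost_arg_B:
  "2 * rate_boost x * (rate_scale x y * arg_B x y + rate_boost x * arg_A x y) =
     x * (1 - x\<^sup>2) * (1 + (arg_B x y)\<^sup>2)"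
  unfolding arg_A_def arg_B_def rate_scale_def rate_boost_def using nz
  by (simp add: divide_simps) algebra

end

text \<open>Write \<open>L h = (x (1 - x\<^sup>2) h')' - x h\<close>. The lemma computes \<open>x (1 - x\<^sup>2) L (p\<^sub>m / (1 + x y))\<close> by
  applying the derivation twice. The result is a combination of \<open>p\<^sub>m\<close> and \<open>p\<^sub>m\<^sub>-\<^sub>1\<close> in which the
  factor \<open>x (1 - x\<^sup>2)\<close> cancels and the coefficients depend on \<open>A\<close> and \<open>B\<close> only:
  \<open>(1 + x y) L (p\<^sub>m / (1 + x y)) = - (m + 1) (2 m + 1) A p\<^sub>m + (m\<^sup>2 + m (m + 1) B\<^sup>2) p\<^sub>m\<^sub>-\<^sub>1\<close>.
  By Bonnet's recurrence the right-hand side is \<open>m\<^sup>2 p\<^sub>m\<^sub>-\<^sub>1 - (m + 1)\<^sup>2 p\<^sub>m\<^sub>+\<^sub>1\<close>.\<close>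
lemma has_flux_legendre_term:
  fixes m :: nat
  assumes nz: "1 + x*y \<noteq> 0"
  defines "P \<equiv> \<lambda>k x. legendre_hom k (arg_A x y) (arg_B x y)"
  defines "s \<equiv> \<lambda>x. 1 / (1 + x*y)"
  defines "E \<equiv> \<lambda>x. s x * ((real m * rate_scale x y + rate_prefactor x y) * P m x
      + rate_boost x * (real m * (arg_B x y * P (m - 1) x)))"
  shows "has_flux (\<lambda>x. s x * P m x) (E x) x"
    and "has_flux E (x * (1 - x\<^sup>2) * (x * (s x * P m x) +
      s x * ((real m)\<^sup>2 * P (m - 1) x - (real m + 1)\<^sup>2 * P (Suc m) x))) x"
proof -
  note AB = has_flux_arg_A[OF nz] has_flux_arg_B[OF nz]
  have P: "has_flux (P k) (real k * (rate_scale x y * P k x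
      + rate_boost x * arg_B x y * P (k - 1) x)) x" for k
    using has_flux_legendre_hom[OF AB, of k] by (simp add: P_def)
  have s: "has_flux s (rate_prefactor x y * s x) x"
    using has_flux_prefactor[OF nz] by (simp add: s_def)
  show "has_flux (\<lambda>x. s x * P m x) (E x) x"
    by (rule has_flux_cong[OF has_flux_mult[OF s P]]) (simp add: E_def algebra_simps)
  \<comment> \<open>The factor \<open>real m\<close> stays inside, so that \<open>m = 0\<close>, where the index \<open>m - 1\<close> is truncated, is covered too.\<close>
  have Q: "has_flux (\<lambda>x. real m * (arg_B x y * P (m - 1) x))
      (real m * (real m * rate_scale x y * arg_B x y * P (m - 1) x
        + 2 * real m * rate_boost x * arg_A x y * P (m - 1) x
        - real m * rate_boost x * P m x)) x"
  proof (cases m)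
    case 0
    then show ?thesis by (simp add: has_flux_const)
  next
    case (Suc k)
    have rec: "(real k + 1) * P m x = (2 * real k + 1) * arg_A x y * P k x
        - real k * (arg_B x y)\<^sup>2 * P (k - 1) x"
      using legendre_hom_rec[of k "arg_A x y" "arg_B x y"] by (simp add: P_def Suc)
    have flux: "has_flux (\<lambda>x. arg_B x y * P k x)
        ((rate_scale x y * arg_B x y + rate_boost x * arg_A x y) * P k x + arg_B x y *
          (real k * (rate_scale x y * P k x + rate_boost x * arg_B x y * P (k - 1) x))) x"
      by (rule has_flux_mult[OF AB(2) P])
    have "(rate_scale x y * arg_B x y + rate_boost x * arg_A x y) * P k x + arg_B x y *
          (real k * (rate_scale x y * P k x + rate_boost x * arg_B x y * P (k - 1) x)) =
        real m * rate_scale x y * arg_B x y * P k x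
        + 2 * real m * rate_boost x * arg_A x y * P k x
        - rate_boost x * ((real k + 1) * P m x)"
      unfolding rec by (simp add: Suc algebra_simps power2_eq_square)
    from has_flux_cong[OF flux this] show ?thesis
      by (intro has_flux_cmult) (simp add: Suc algebra_simps)
  qed
  let ?p = "x * (1 - x\<^sup>2)" and ?\<mu> = "real m" and ?\<alpha> = "rate_scale x y" and ?\<gamma> = "rate_boost x"
    and ?\<sigma> = "rate_prefactor x y" and ?A = "arg_A x y" and ?B = "arg_B x y"
    and ?P = "P m x" and ?P' = "P (m - 1) x"
  have rec: "(?\<mu> + 1) * P (Suc m) x = (2 * ?\<mu> + 1) * ?A * ?P - ?\<mu> * ?B\<^sup>2 * ?P'"
    using legendre_hom_rec[of m ?A ?B] by (simp add: P_def)
  let ?rates = "(?\<mu> * (- 3 * ?p * ?A - 2 * ?\<sigma> * ?\<alpha>) + (?p * (x - ?A) - ?\<sigma>\<^sup>2)) * ?P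
      + (?\<mu> * ?\<alpha> + ?\<sigma>) * (?\<mu> * (?\<alpha> * ?P + ?\<gamma> * ?B * ?P'))"
  let ?boost = "(?p * ?B - 2 * ?\<sigma> * ?\<gamma>) * (?\<mu> * (?B * ?P'))
      + ?\<gamma> * (?\<mu> * (?\<mu> * ?\<alpha> * ?B * ?P' + 2 * ?\<mu> * ?\<gamma> * ?A * ?P' - ?\<mu> * ?\<gamma> * ?P))"
  have flux: "has_flux E (?\<sigma> * s x * ((?\<mu> * ?\<alpha> + ?\<sigma>) * ?P + ?\<gamma> * (?\<mu> * (?B * ?P')))
      + s x * (?rates + ?boost)) x"
    unfolding E_def
    by (intro has_flux_mult has_flux_add has_flux_cmult s P Q has_flux_rate_scale[OF nz]
        has_flux_rate_boost[OF nz] has_flux_rate_prefactor[OF nz])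
  have "?\<sigma> * s x * ((?\<mu> * ?\<alpha> + ?\<sigma>) * ?P + ?\<gamma> * (?\<mu> * (?B * ?P'))) + s x * (?rates + ?boost) =
      s x * (?\<mu>\<^sup>2 * (?\<alpha>\<^sup>2 - ?\<gamma>\<^sup>2) * ?P + ?\<mu>\<^sup>2 * (2 * ?\<gamma> * (?\<alpha> * ?B + ?\<gamma> * ?A)) * ?P'
        + (?p * (x - ?A) - 3 * ?\<mu> * ?p * ?A) * ?P + ?\<mu> * ?p * ?B\<^sup>2 * ?P')"
    by (simp add: algebra_simps power2_eq_square)
  also have "\<dots> = ?p * (x * (s x * ?P) + s x * (?\<mu>\<^sup>2 * ?P'
      - (?\<mu> + 1) * ((2 * ?\<mu> + 1) * ?A * ?P - ?\<mu> * ?B\<^sup>2 * ?P')))"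
    unfolding rate_scale_boost_squares[OF nz] rate_boost_arg_B[OF nz]
    by (simp add: algebra_simps power2_eq_square)
  also have "\<dots> = ?p * (x * (s x * ?P) + s x * (?\<mu>\<^sup>2 * ?P' - (?\<mu> + 1)\<^sup>2 * P (Suc m) x))"
    unfolding rec[symmetric] by (simp add: power2_eq_square mult.assoc)
  finally show "has_flux E (?p * (x * (s x * ?P) +
      s x * (?\<mu>\<^sup>2 * ?P' - (?\<mu> + 1)\<^sup>2 * P (Suc m) x))) x"
    using flux by simp
qed

section \<open>Telescoping and separation of variables\<close>

text \<open>Consecutive even degrees contribute the same odd degree \<open>2 n + 1\<close> with opposite signs, because
  the weights satisfy \<open>(2 n + 2)\<^sup>2 w\<^sub>n\<^sub>+\<^sub>1 = (2 n + 1)\<^sup>2 w\<^sub>n\<close>.\<close>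
lemma central_weight_telescope:
  fixes P :: "nat \<Rightarrow> real"
  shows "(\<Sum>n<N. central_weight n * ((real (2*n))\<^sup>2 * P (2*n - 1) - (real (2*n) + 1)\<^sup>2 * P (Suc (2*n))))
    = - (central_weight N * (real (2*N))\<^sup>2 * P (2*N - 1))"
proof (induction N)
  case (Suc N)
  have "central_weight (Suc N) * (real (2 * Suc N))\<^sup>2 = central_weight N * (real (2*N) + 1)\<^sup>2"
    using central_weight_Suc[of N] by (simp add: power2_eq_square algebra_simps)
  then show ?case
    using Suc by (simp add: algebra_simps)
qed simp

lemma abs_args_le:
  assumes "\<bar>x - 1\<bar> < 1/20" "\<bar>y - 1\<bar> < 1/20"
  shows "1 \<le> 1 + x*y" "\<bar>arg_A x y\<bar> \<le> 1/6" "\<bar>arg_B x y\<bar> \<le> 1/6"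
proof -
  have b: "19/20 \<le> x" "x \<le> 21/20" "19/20 \<le> y" "y \<le> 21/20"
    using assms by (auto simp: abs_if split: if_splits)
  have lo: "19/20 * (19/20) \<le> x * y" and hi: "x * y \<le> 21/20 * (21/20)"
    using b by (intro mult_mono; simp)+
  then show "1 \<le> 1 + x*y" by simp
  have sq: "1 \<le> (1 + x*y)\<^sup>2"
    using lo by (intro one_le_power) simp
  have "\<bar>arg_A x y\<bar> = \<bar>x + y\<bar> * \<bar>1 - x*y\<bar> / (1 + x*y)\<^sup>2"
    by (simp add: arg_A_def abs_mult)
  also have "\<dots> \<le> (21/10 * (41/400)) / (19/10)\<^sup>2"
    using b lo hi by (intro frac_le mult_mono power_mono) (auto simp: abs_if)
  also have "\<dots> \<le> 1/6" by (simp add: power2_eq_square)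
  finally show "\<bar>arg_A x y\<bar> \<le> 1/6" .
  have "\<bar>arg_B x y\<bar> = \<bar>x - y\<bar> / (1 + x*y)"
    using lo by (simp add: arg_B_def)
  also have "\<dots> \<le> (1/10) / (19/10)"
    using b lo by (intro frac_le) (auto simp: abs_if)
  finally show "\<bar>arg_B x y\<bar> \<le> 1/6" by simp
qed

definition product_series :: "real \<Rightarrow> real \<Rightarrow> real" where
  "product_series x y =
     (\<Sum>n. central_weight n * legendre_hom (2*n) (arg_A x y) (arg_B x y))"

lemma product_series_commute: "product_series x y = product_series y x"
proof -
  have "arg_A x y = arg_A y x" by (simp add: arg_A_def add.commute mult.commute)
  moreover have "arg_B y x = - arg_B x y"
    by (simp add: arg_B_def mult.commute minus_divide_left)
  ultimately show ?thesis by (simp add: product_series_def)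
qed

lemma product_series_1_1: "product_series 1 1 = 1"
proof -
  have "legendre_hom (2*n) 0 0 = (if n = 0 then 1 else 0)" for n
    using abs_legendre_hom_le[of 0 0 0 "2*n"] by (auto simp: power_0_left split: if_splits)
  then have "product_series 1 1 = (\<Sum>n. if n = 0 then 1 else 0)"
    unfolding product_series_def by (intro suminf_cong) (simp add: arg_A_def arg_B_def)
  then show ?thesis
    using sums_unique[OF sums_single[of 0 "\<lambda>_. 1::real"]] by simp
qed

lemma summable_product_series:
  assumes "\<bar>x - 1\<bar> < 1/20" "\<bar>y - 1\<bar> < 1/20"
  shows "summable (\<lambda>n. central_weight n * legendre_hom (2*n) (arg_A x y) (arg_B x y))"
proof (rule summable_comparison_test')
  show "summable (\<lambda>n. (1/4::real) ^ n)" by (simp add: summable_geometric)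
  show "norm (central_weight n * legendre_hom (2*n) (arg_A x y) (arg_B x y)) \<le> (1/4) ^ n" for n
  proof -
    have "norm (central_weight n * legendre_hom (2*n) (arg_A x y) (arg_B x y))
        \<le> 1 * (3 * (1/6)) ^ (2*n)"
      unfolding real_norm_def abs_mult
      using central_weight_nonneg central_weight_le_1 abs_args_le[OF assms]
      by (intro mult_mono abs_legendre_hom_le) auto
    then show ?thesis by (simp add: power_mult power2_eq_square)
  qed
qed

text \<open>For fixed \<open>y\<close>, the \<open>N\<close>-th partial sum divided by \<open>1 + x y\<close> solves the elliptic equation up to
  the residual left by telescoping, which is at most \<open>8 N\<^sup>2 / 4\<^sup>N\<close> because \<open>\<bar>A\<bar>, \<bar>B\<bar> \<le> 1/6\<close>. In
  the limit, uniqueness at \<open>x = 1\<close> makes the sum proportional to the regular solution.\<close>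
lemma product_series_separates:
  assumes \<delta>: "\<delta> \<le> 1/20"
    and bounds: "\<And>t. \<bar>t - 1\<bar> < \<delta> \<Longrightarrow> 1/2 < ellK_compl t \<and> ellK_compl t < 2"
    and x: "\<bar>x - 1\<bar> < \<delta>" and y: "\<bar>y - 1\<bar> < \<delta>"
  shows "product_series x y / (1 + x*y) = product_series 1 y / (1 + y) * ellK_compl x"
proof -
  define P where "P = (\<lambda>k t. legendre_hom k (arg_A t y) (arg_B t y))"
  define s where "s = (\<lambda>t. 1 / (1 + t*y))"
  define h where "h = (\<lambda>N t. \<Sum>n<N. central_weight n * (s t * P (2*n) t))"
  define E where "E = (\<lambda>N t. \<Sum>n<N. central_weight n *
    (s t * ((real (2*n) * rate_scale t y + rate_prefactor t y) * P (2*n) t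
      + rate_boost t * (real (2*n) * (arg_B t y * P (2*n - 1) t)))))"
  define r where "r = (\<lambda>N t. - (s t * (central_weight N * (real (2*N))\<^sup>2 * P (2*N - 1) t)))"
  define \<epsilon> where "\<epsilon> = (\<lambda>N. 8 * (real N * (1/2) ^ N)\<^sup>2)"
  have small: "\<bar>t - 1\<bar> < 1/20" if "\<bar>t - 1\<bar> < \<delta>" for t
    using that \<delta> by linarith
  note y' = small[OF y]
  have nz: "1 \<le> 1 + t*y" "1 + t*y \<noteq> 0" if "\<bar>t - 1\<bar> < \<delta>" for t
    using abs_args_le(1)[OF small[OF that] y'] by linarith+
  have h: "has_flux (h N) (E N t) t" if "\<bar>t - 1\<bar> < \<delta>" for N t
    unfolding h_def E_def P_def s_def
    by (intro has_flux_sum has_flux_cmult has_flux_legendre_term(1) nz[OF that])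
  have E: "has_flux (E N) (t * (1 - t\<^sup>2) * (t * h N t + r N t)) t" if t: "\<bar>t - 1\<bar> < \<delta>" for N t
  proof -
    let ?d = "\<lambda>n. (real (2*n))\<^sup>2 * P (2*n - 1) t - (real (2*n) + 1)\<^sup>2 * P (Suc (2*n)) t"
    have "has_flux (E N) (\<Sum>n<N. central_weight n *
        (t * (1 - t\<^sup>2) * (t * (s t * P (2*n) t) + s t * ?d n))) t"
      unfolding E_def P_def s_def
      by (intro has_flux_sum has_flux_cmult has_flux_legendre_term(2) nz[OF t])
    moreover have "(\<Sum>n<N. central_weight n *
        (t * (1 - t\<^sup>2) * (t * (s t * P (2*n) t) + s t * ?d n))) =
        t * (1 - t\<^sup>2) * (t * h N t + s t * (\<Sum>n<N. central_weight n * ?d n))"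
      unfolding h_def sum_distrib_left sum.distrib[symmetric]
      by (intro sum.cong refl) (simp add: algebra_simps)
    ultimately show ?thesis
      using central_weight_telescope[of "\<lambda>k. P k t" N] by (simp add: r_def)
  qed
  have r: "\<bar>r N t\<bar> \<le> \<epsilon> N" if t: "\<bar>t - 1\<bar> < \<delta>" for N t
  proof -
    have "\<bar>P (2*N - 1) t\<bar> \<le> (3 * (1/6)) ^ (2*N - 1)"
      unfolding P_def using abs_args_le[OF small[OF t] y'] by (intro abs_legendre_hom_le)
    also have "\<dots> \<le> 2 * (1/2) ^ (2*N)"
      by (cases N) simp_all
    finally have P_le: "\<bar>P (2*N - 1) t\<bar> \<le> 2 * (1/2) ^ (2*N)" .
    have "\<bar>r N t\<bar> = \<bar>s t\<bar> * (central_weight N * (real (2*N))\<^sup>2 * \<bar>P (2*N - 1) t\<bar>)"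
      using central_weight_nonneg[of N] by (simp add: r_def abs_mult)
    also have "\<dots> \<le> 1 * (1 * (real (2*N))\<^sup>2 * (2 * (1/2) ^ (2*N)))"
      using nz(1)[OF t] P_le central_weight_nonneg[of N] central_weight_le_1[of N]
      by (intro mult_mono) (auto simp: s_def)
    also have "\<dots> = \<epsilon> N"
      by (simp add: \<epsilon>_def power_mult_distrib power_mult[symmetric] mult.commute[of 2 N])
    finally show ?thesis .
  qed
  have "\<epsilon> \<longlonglongrightarrow> 8 * 0\<^sup>2"
    unfolding \<epsilon>_def by (intro tendsto_intros powser_times_n_limit_0) auto
  then have \<epsilon>_lim: "(\<lambda>N. 8 * \<epsilon> N) \<longlonglongrightarrow> 0"
    using tendsto_mult_left[of \<epsilon> 0 sequentially 8] by simp
  have h_lim: "(\<lambda>N. h N t) \<longlonglongrightarrow> s t * product_series t y" if t: "\<bar>t - 1\<bar> < \<delta>" for t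
  proof -
    have "(\<lambda>N. s t * (\<Sum>n<N. central_weight n * P (2*n) t)) \<longlonglongrightarrow> s t * product_series t y"
      unfolding P_def product_series_def
      by (intro tendsto_intros summable_LIMSEQ summable_product_series small t y)
    moreover have "h N t = s t * (\<Sum>n<N. central_weight n * P (2*n) t)" for N
      unfolding h_def sum_distrib_left by (intro sum.cong refl) (simp add: mult_ac)
    ultimately show ?thesis by simp
  qed
  have one: "\<bar>1 - 1\<bar> < \<delta>" using x by linarith
  have disc: "\<bar>1 - t\<^sup>2\<bar> < 1" if "\<bar>t - 1\<bar> < \<delta>" for t
    using small[OF that] by (intro near_1_square_bound) linarith
  note g = ellK_compl_ode(1)[OF disc] and G = ellK_compl_ode(2)[OF disc]
  have "\<bar>h N x / ellK_compl x - h N 1 / ellK_compl 1\<bar> \<le> 8 * \<epsilon> N" for N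
    by (rule wronskian_estimate[OF \<delta> x g G bounds h E r])
  then have "(\<lambda>N. h N x / ellK_compl x - h N 1 / ellK_compl 1) \<longlonglongrightarrow> 0"
    by (intro Lim_null_comparison[OF _ \<epsilon>_lim] always_eventually) auto
  moreover have "(\<lambda>N. h N x / ellK_compl x - h N 1 / ellK_compl 1) \<longlonglongrightarrow>
      s x * product_series x y / ellK_compl x - s 1 * product_series 1 y / ellK_compl 1"
    using bounds[OF x] by (intro tendsto_intros h_lim x one) auto
  ultimately have "s x * product_series x y / ellK_compl x
      - s 1 * product_series 1 y / ellK_compl 1 = 0"
    by (rule LIMSEQ_unique[rotated])
  then have "s x * product_series x y / ellK_compl x = s 1 * product_series 1 y"
    by simp
  then have "s x * product_series x y = s 1 * product_series 1 y * ellK_compl x"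
    using bounds[OF x] by (simp add: divide_eq_eq)
  then show ?thesis by (simp add: s_def)
qed

text \<open>Separation applied at \<open>(y, 1)\<close> evaluates, by symmetry, the value at \<open>(1, y)\<close> left open by the
  separation at \<open>(x, y)\<close>.\<close>
lemma product_series_eq:
  assumes \<delta>: "\<delta> \<le> 1/20"
    and bounds: "\<And>t. \<bar>t - 1\<bar> < \<delta> \<Longrightarrow> 1/2 < ellK_compl t \<and> ellK_compl t < 2"
    and x: "\<bar>x - 1\<bar> < \<delta>" and y: "\<bar>y - 1\<bar> < \<delta>"
  shows "2 * product_series x y = (1 + x*y) * ellK_compl x * ellK_compl y"
proof -
  have one: "\<bar>1 - 1\<bar> < \<delta>" using x by linarith
  have "product_series y 1 / (1 + y) = ellK_compl y / 2"
    using product_series_separates[OF \<delta> bounds y one] by (simp add: product_series_1_1)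
  moreover have "product_series x y / (1 + x*y) = product_series 1 y / (1 + y) * ellK_compl x"
    by (rule product_series_separates[OF \<delta> bounds x y])
  ultimately have "product_series x y / (1 + x*y) = ellK_compl y / 2 * ellK_compl x"
    by (simp only: product_series_commute[of 1 y])
  moreover have "1 + x*y \<noteq> 0"
    using abs_args_le(1)[of x y] x y \<delta> by linarith
  ultimately show ?thesis by (simp add: field_simps)
qed

theorem theorem4:
  shows "\<exists>U::real set. open U \<and> 1 \<in> U \<and>
    (\<forall>x\<in>U. \<forall>y\<in>U.
      summable (\<lambda>n. (pochhammer (1/2) n)\<^sup>2 / (fact n)\<^sup>2 * legendre_term n x y) \<and>
      (let S = pi\<^sup>2 / 2 * (\<Sum>n. (pochhammer (1/2) n)\<^sup>2 / (fact n)\<^sup>2 * legendre_term n x y)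
       in
        (x = 1 \<and> y = 1 \<longrightarrow> S = pi\<^sup>2 / 2) \<and>
        (x \<ge> 1 \<and> y \<ge> 1 \<longrightarrow>
          S = (1 + x*y) / (x*y) * ellK (sqrt (x\<^sup>2 - 1) / x) * ellK (sqrt (y\<^sup>2 - 1) / y)) \<and>
        (x \<ge> 1 \<and> y \<le> 1 \<longrightarrow>
          S = (1 + x*y) / x * ellK (sqrt (x\<^sup>2 - 1) / x) * ellK (sqrt (1 - y\<^sup>2))) \<and>
        (x \<le> 1 \<and> y \<ge> 1 \<longrightarrow>
          S = (1 + x*y) / y * ellK (sqrt (1 - x\<^sup>2)) * ellK (sqrt (y\<^sup>2 - 1) / y)) \<and>
        (x \<le> 1 \<and> y \<le> 1 \<longrightarrow>
          S = (1 + x*y) * ellK (sqrt (1 - x\<^sup>2)) * ellK (sqrt (1 - y\<^sup>2)))))"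
proof -
  obtain \<delta> where \<delta>: "0 < \<delta>" "\<delta> \<le> 1/20"
    and bounds: "\<And>t. \<bar>t - 1\<bar> < \<delta> \<Longrightarrow> 1/2 < ellK_compl t \<and> ellK_compl t < 2"
    by (rule ellK_compl_bounds_near_1) blast
  have below: "ellK (sqrt (1 - t\<^sup>2)) = pi / 2 * ellK_compl t" if "0 < t" "t \<le> 1" for t
    using that by (simp add: ellK_def ellK_compl_def power_le_one)
  have above: "ellK (sqrt (t\<^sup>2 - 1) / t) = pi / 2 * (t * ellK_compl t)"
    if t: "\<bar>t - 1\<bar> < \<delta>" "t \<ge> 1" for t
  proof -
    have "(sqrt (t\<^sup>2 - 1) / t)\<^sup>2 = 1 - (1 / t)\<^sup>2"
      using t by (simp add: power_divide diff_divide_distrib)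
    then have "ellK (sqrt (t\<^sup>2 - 1) / t) = pi / 2 * ellK_compl (1 / t)"
      by (simp add: ellK_def ellK_compl_def)
    also have "ellK_compl (1 / t) = t * ellK_compl t"
      using ellK_compl_inverse[OF \<delta>(2) t(1) bounds] t by (simp add: field_simps)
    finally show ?thesis .
  qed
  show ?thesis
  proof (intro exI[of _ "{1 - \<delta><..<1 + \<delta>}"] conjI ballI)
    fix x y assume "x \<in> {1 - \<delta><..<1 + \<delta>}" "y \<in> {1 - \<delta><..<1 + \<delta>}"
    then have xy: "\<bar>x - 1\<bar> < \<delta>" "\<bar>y - 1\<bar> < \<delta>"
      by (auto simp: abs_if)
    then have small: "\<bar>x - 1\<bar> < 1/20" "\<bar>y - 1\<bar> < 1/20" and pos: "0 < x" "0 < y"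
      using \<delta> by linarith+
    have summand: "(pochhammer (1/2) n)\<^sup>2 / (fact n)\<^sup>2 * legendre_term n x y =
        central_weight n * legendre_hom (2*n) (arg_A x y) (arg_B x y)" for n
      using abs_args_le(1)[OF small]
      by (subst legendre_term_eq_hom) (auto simp: central_weight_def arg_A_def arg_B_def)
    show "summable (\<lambda>n. (pochhammer (1/2) n)\<^sup>2 / (fact n)\<^sup>2 * legendre_term n x y)"
      unfolding summand by (rule summable_product_series[OF small])
    have S: "pi\<^sup>2 / 2 * (\<Sum>n. (pochhammer (1/2) n)\<^sup>2 / (fact n)\<^sup>2 * legendre_term n x y) =
        (1 + x*y) * (pi / 2 * ellK_compl x) * (pi / 2 * ellK_compl y)"
      using product_series_eq[OF \<delta>(2) bounds xy]
      unfolding summand product_series_def[symmetric]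
      by (simp add: power2_eq_square field_simps)
    show "let S = pi\<^sup>2 / 2 * (\<Sum>n. (pochhammer (1/2) n)\<^sup>2 / (fact n)\<^sup>2 * legendre_term n x y)
       in
        (x = 1 \<and> y = 1 \<longrightarrow> S = pi\<^sup>2 / 2) \<and>
        (x \<ge> 1 \<and> y \<ge> 1 \<longrightarrow>
          S = (1 + x*y) / (x*y) * ellK (sqrt (x\<^sup>2 - 1) / x) * ellK (sqrt (y\<^sup>2 - 1) / y)) \<and>
        (x \<ge> 1 \<and> y \<le> 1 \<longrightarrow>
          S = (1 + x*y) / x * ellK (sqrt (x\<^sup>2 - 1) / x) * ellK (sqrt (1 - y\<^sup>2))) \<and>
        (x \<le> 1 \<and> y \<ge> 1 \<longrightarrow>
          S = (1 + x*y) / y * ellK (sqrt (1 - x\<^sup>2)) * ellK (sqrt (y\<^sup>2 - 1) / y)) \<and>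
        (x \<le> 1 \<and> y \<le> 1 \<longrightarrow>
          S = (1 + x*y) * ellK (sqrt (1 - x\<^sup>2)) * ellK (sqrt (1 - y\<^sup>2)))"
      unfolding Let_def S
    proof (intro conjI impI; elim conjE)
      assume "x = 1" "y = 1"
      then show "(1 + x*y) * (pi / 2 * ellK_compl x) * (pi / 2 * ellK_compl y) = pi\<^sup>2 / 2"
        by (simp add: power2_eq_square)
    qed (use pos in \<open>simp_all add: below above[OF xy(1)] above[OF xy(2)]\<close>)
  qed (use \<delta> in auto)
qed

end
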